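(* Let $n_1,n_2\ge 1$ be integers. The number of acyclic orientations of the complete bipartite graph $K_{n_1,n_2}$ is $$a(K_{n_1,n_2})=\sum_{j=1}^{\min\{n_1+1,n_2+1\}}\bigl((j-1)!\bigr)^2\,S(n_1+1,j)\,S(n_2+1,j).$$
   Context: An acyclic orientation of a graph $G$ is an assignment of a direction to each edge of $G$ such that the resulting directed graph has no directed cycles; $a(G)$ denotes the number of acyclic orientations of $G$ (vertices are labelled). $K_{n_1,n_2}$ is the complete bipartite graph with parts of sizes $n_1$ and $n_2$. $S(n,k)$ is the Stirling number of the second kind, the number of partitions of an $n$-element set into $k$ non-empty subsets. *)

theory Defs
  imports "Graph_Theory.Graph_Theory" "HOL-Combinatorics.Stirling" "HOL-Library.Disjoint_Sets"
begin

text \<open>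
  Undirected graphs are symmetric loop-free digraphs without parallel arcs (locale \<open>graph\<close>), so
  an undirected edge uv is a pair of opposite arcs. Directing the edge means keeping exactly one of
  the two; hence an orientation is a spanning subdigraph. Since it shares its vertices, tail and
  head functions with the graph, it is determined by its set of arcs, and distinct orientations of
  the labelled graph are distinct values.
\<close>

definition orientation :: "('a,'b) pre_digraph \<Rightarrow> ('a,'b) pre_digraph \<Rightarrow> bool" where
  "orientation D G \<longleftrightarrow>
     spanning D G \<and> (\<forall>u v. u \<rightarrow>\<^bsub>G\<^esub> v \<longrightarrow> (u \<rightarrow>\<^bsub>D\<^esub> v) \<noteq> (v \<rightarrow>\<^bsub>D\<^esub> u))"

definition acyclic_orientation :: "('a,'b) pre_digraph \<Rightarrow> ('a,'b) pre_digraph \<Rightarrow> bool" where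
  "acyclic_orientation D G \<longleftrightarrow> orientation D G \<and> \<not> (\<exists>p. pre_digraph.cycle D p)"

definition num_acyclic_orientations :: "('a,'b) pre_digraph \<Rightarrow> nat" where
  "num_acyclic_orientations G = card {D. acyclic_orientation D G}"

text \<open>The set counted above is finite, so \<open>card\<close> has its intended meaning.\<close>

lemma finite_acyclic_orientations:
  assumes "graph G"
  shows "finite {D. acyclic_orientation D G}"
proof -
  interpret graph G by fact
  have "{D. acyclic_orientation D G} \<subseteq>
      (\<lambda>A. \<lparr>verts = verts G, arcs = A, tail = tail G, head = head G\<rparr>) ` Pow (arcs G)"
  proof
    fix D assume "D \<in> {D. acyclic_orientation D G}"
    then have "arcs D \<subseteq> arcs G"
      and "D = \<lparr>verts = verts G, arcs = arcs D, tail = tail G, head = head G\<rparr>"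
      by (simp_all add: acyclic_orientation_def orientation_def spanning_def subgraph_def
          compatible_def)
    then show "D \<in> (\<lambda>A. \<lparr>verts = verts G, arcs = A, tail = tail G, head = head G\<rparr>) ` Pow (arcs G)"
      by blast
  qed
  then show ?thesis
    by (rule finite_subset) simp
qed

text \<open>
  The library defines \<open>Stirling\<close> by its recurrence; it counts the partitions of a finite set
  into a given number of non-empty blocks.
\<close>

lemma card_partitions_eq_Stirling:
  assumes "finite A"
  shows "card {P. partition_on A P \<and> card P = k} = Stirling (card A) k"
  using assms
proof (induction A arbitrary: k rule: finite_induct)
  case empty
  have "{P. partition_on {} P \<and> card P = k} = (if k = 0 then {{}} else {})"
    by (auto simp: partition_on_empty)
  then have "card {P. partition_on ({}::'a set) P \<and> card P = k} = card (if k = 0 then {{}::'a set set} else {})"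
    by (rule arg_cong)
  then show ?case by (cases k) simp_all
next
  case (insert x A)
  show ?case
  proof (cases k)
    case 0
    have "card P \<noteq> 0" if "partition_on (insert x A) P" for P
      using that finite_elements[of "insert x A" P] insert.hyps
      by (auto simp: partition_on_def)
    then have "{P. partition_on (insert x A) P \<and> card P = k} = {}"
      using 0 by auto
    then have "card {P. partition_on (insert x A) P \<and> card P = k} = 0"
      by (simp only: card.empty)
    then show ?thesis using 0 insert.hyps by simp
  next
    case (Suc j)
    define S where "S = (\<lambda>i. {P. partition_on A P \<and> card P = i})"
    have finS: "finite (S i)" for i
      unfolding S_def using finitely_many_partition_on[OF insert.hyps(1)]
      by (rule rev_finite_subset) auto
    have finP: "finite P" if "P \<in> S i" for P i
      using that insert.hyps(1) finite_elements unfolding S_def by auto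
    have xP: "x \<notin> p" if "P \<in> S i" "p \<in> P" for P i p
      using that insert.hyps(2) unfolding S_def partition_on_def by auto
    define f where "f = (\<lambda>(P, p). insert (insert x p) (P - {p}))"
    define T where "T = (SIGMA P:S (Suc j). P)"
    have eq: "{P. partition_on (insert x A) P \<and> card P = k} = insert {x} ` S j \<union> f ` T"
      (is "?L = ?R")
    proof (intro equalityI subsetI)
      fix Q assume "Q \<in> ?L"
      then have Q: "partition_on (insert x A) Q" "card Q = Suc j" using Suc by auto
      then obtain q where q: "q \<in> Q" "x \<in> q" by (auto simp: partition_on_def)
      define R where "R = Q - {q}"
      have QR: "Q = insert q R" "q \<notin> R" using q by (auto simp: R_def)
      have finR: "finite R"
        using Q(1) insert.hyps(1) finite_elements[of "insert x A" Q] by (auto simp: R_def)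
      have cR: "card R = j" using Q(2) QR finR by simp
      have dj: "disjnt q (\<Union>R)"
        using partition_onD2[OF Q(1)] q by (auto simp: R_def disjnt_def dest: disjointD)
      have pR: "partition_on (insert x A - q) R" and qs: "q \<subseteq> insert x A"
        using Q(1) QR partition_on_insert[OF dj] by auto
      show "Q \<in> ?R"
      proof (cases "q = {x}")
        case True
        then have "R \<in> S j" using pR cR insert.hyps(2) by (simp add: S_def)
        then show ?thesis using QR True by auto
      next
        case False
        define p where "p = q - {x}"
        have pq: "insert x p = q" "p \<noteq> {}" using False q by (auto simp: p_def)
        have dp: "disjnt p (\<Union>R)" using dj by (auto simp: p_def disjnt_def)
        have "A - p = insert x A - q" using q insert.hyps(2) by (auto simp: p_def)
        then have "partition_on A (insert p R)"
          using partition_on_insert[OF dp, of A] pR pq qs by (auto simp: p_def)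
        moreover have "p \<notin> R" using dp pq by (auto simp: disjnt_def)
        ultimately have "(insert p R, p) \<in> T" "f (insert p R, p) = Q"
          using cR finR QR pq by (auto simp: T_def S_def f_def)
        then show ?thesis by blast
      qed
    next
      fix Q assume "Q \<in> ?R"
      then show "Q \<in> ?L"
      proof
        assume "Q \<in> insert {x} ` S j"
        then obtain P where P: "P \<in> S j" "Q = insert {x} P" by auto
        have d: "disjnt {x} (\<Union>P)" using xP[OF P(1)] by (auto simp: disjnt_def)
        have "{x} \<notin> P" using xP[OF P(1)] by auto
        then show ?thesis
          using P finP[OF P(1)] Suc insert.hyps(2) partition_on_insert[OF d, of "insert x A"]
          by (auto simp: S_def)
      next
        assume "Q \<in> f ` T"
        then obtain P p where P: "P \<in> S (Suc j)" "p \<in> P" "Q = insert (insert x p) (P - {p})"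
          by (auto simp: T_def f_def)
        have d: "disjnt p (\<Union>(P - {p}))"
          using P(1,2) by (auto simp: S_def partition_on_def disjnt_def dest: disjointD)
        have d': "disjnt (insert x p) (\<Union>(P - {p}))" using d xP[OF P(1)] by (auto simp: disjnt_def)
        have "insert p (P - {p}) = P" using P by auto
        then have "partition_on (A - p) (P - {p})" "p \<subseteq> A"
          using partition_on_insert[OF d, of A] P by (auto simp: S_def)
        moreover have "insert x A - insert x p = A - p" using insert.hyps(2) by auto
        ultimately have "partition_on (insert x A) Q"
          using partition_on_insert[OF d', of "insert x A"] P(3) by auto
        moreover have "insert x p \<notin> P - {p}" using xP[OF P(1)] by auto
        ultimately show ?thesis
          using P finP[OF P(1)] Suc by (auto simp: S_def)
      qed
    qed
    have inj1: "inj_on (insert {x}) (S j)"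
    proof (rule inj_onI)
      fix P P' assume a: "P \<in> S j" "P' \<in> S j" "insert {x} P = insert {x} P'"
      have "{x} \<notin> P" "{x} \<notin> P'" using xP a by auto
      then show "P = P'" using a(3) by (metis insert_ident)
    qed
    have inj2: "inj_on f T"
    proof (rule inj_onI, clarsimp simp: T_def f_def)
      fix P p P' p'
      assume a: "P \<in> S (Suc j)" "p \<in> P" "P' \<in> S (Suc j)" "p' \<in> P'"
        and e: "insert (insert x p) (P - {p}) = insert (insert x p') (P' - {p'})"
      have x: "x \<notin> p" "x \<notin> p'" "\<And>r. r \<in> P - {p} \<Longrightarrow> x \<notin> r" "\<And>r. r \<in> P' - {p'} \<Longrightarrow> x \<notin> r"
        using xP a by auto
      have "insert x p \<in> insert (insert x p') (P' - {p'})" using e by blast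
      then have i: "insert x p = insert x p'" using x(4) by blast
      then have pp: "p = p'" using x(1,2) by (metis insert_ident)
      have "insert x p \<notin> P - {p}" "insert x p \<notin> P' - {p'}" using x by blast+
      then have "P - {p} = P' - {p'}" using e i by (metis insert_ident)
      then show "P = P' \<and> p = p'" using pp a by (metis insert_Diff)
    qed
    have disj: "insert {x} ` S j \<inter> f ` T = {}"
    proof (rule ccontr)
      assume "insert {x} ` S j \<inter> f ` T \<noteq> {}"
      then obtain R P p where "P \<in> S (Suc j)" "p \<in> P" "insert {x} R = insert (insert x p) (P - {p})"
        by (force simp: T_def f_def)
      then have P: "P \<in> S (Suc j)" "p \<in> P" "{x} \<in> insert (insert x p) (P - {p})"
        by blast+
      then have "{x} = insert x p" using xP by blast
      then have "p = {}" using xP P(1,2) by blast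
      then show False using P by (auto simp: S_def partition_on_def)
    qed
    have "card ?L = card (S j) + card T"
      unfolding eq using finS finP inj1 inj2 disj
      by (subst card_Un_disjoint) (auto simp: card_image T_def)
    also have "card T = (\<Sum>P\<in>S (Suc j). card P)"
      unfolding T_def using finS finP by (intro card_SigmaI) auto
    also have "\<dots> = Suc j * card (S (Suc j))" by (simp add: S_def)
    finally show ?thesis using insert Suc by (simp add: S_def)
  qed
qed

end

theory Submission
  imports Defs
begin

text \<open>
  Let \<open>U\<close> and \<open>V\<close> be the two parts. An orientation of the complete bipartite graph is the same thing
  as a relation \<open>R \<subseteq> U \<times> V\<close>, namely the set of pairs whose edge points from \<open>U\<close> to \<open>V\<close>. If two
  rows \<open>R `` {u}\<close> and \<open>R `` {u'}\<close> are incomparable for inclusion, then one element of each difference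
  completes a directed 4-cycle through \<open>u\<close> and \<open>u'\<close>. Conversely, if the rows form a chain, then \<open>R\<close> is
  given by a comparison of ranks: \<open>(u, v) \<in> R\<close> iff \<open>g v < f u\<close> for suitable
  \<open>f :: U \<Rightarrow> {0..j}\<close> and \<open>g :: V \<Rightarrow> {0..j}\<close>. Then \<open>2 * f u\<close> on \<open>U\<close> and \<open>2 * g v + 1\<close> on \<open>V\<close> is a
  potential which drops along every arc, and there is no cycle at all. So the acyclic orientations
  correspond to the relations with nested rows (\<open>num_acyclic_orientations_eq_card_ferrers\<close>).

  To count these, take the ranks to be as tight as possible. If \<open>j\<close> is the number of distinct
  non-empty rows, then \<open>f\<close> can be chosen to attain every value in \<open>{1..j}\<close> and \<open>g\<close> to attain every
  value in \<open>{0..<j}\<close>, and under these conditions \<open>j\<close>, \<open>f\<close> and \<open>g\<close> are determined by \<open>R\<close>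
  (\<open>bij_betw_threshold_relation\<close>). The value 0 of \<open>f\<close> (an empty row) and the value \<open>j\<close> of \<open>g\<close> (an
  element in no row) may or may not occur. A function from an \<open>n\<close>-set to a set of \<open>j + 1\<close> points that
  attains every point except possibly one designated point is a partition of the \<open>n\<close>-set together with one dummy
  element into \<open>j + 1\<close> blocks, where the \<open>j\<close> blocks without the dummy are labelled; there are
  \<open>j! * S(n + 1, j + 1)\<close> of them (\<open>card_covering_funs\<close>). The product of the two counts, summed over \<open>j\<close>,
  is the formula, with the summation index shifted by one.
\<close>

section \<open>Functions covering all but one point of the codomain\<close>

definition covering_funs :: "'a set \<Rightarrow> 'c \<Rightarrow> 'c set \<Rightarrow> ('a \<Rightarrow> 'c) set" where
  "covering_funs A b B = {f \<in> A \<rightarrow>\<^sub>E insert b B. B \<subseteq> f ` A}"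

lemma finite_covering_funs:
  "finite A \<Longrightarrow> finite B \<Longrightarrow> finite (covering_funs A b B)"
  unfolding covering_funs_def by (rule finite_subset[of _ "A \<rightarrow>\<^sub>E insert b B"]) (auto intro: finite_PiE)

text \<open>
  Split by whether the functions restricted to \<open>A\<close> still attain all of \<open>B\<close>. If so, the value at \<open>x\<close>
  is free; otherwise the value at \<open>x\<close> is the only point of \<open>B\<close> that the restriction misses. The two
  cases are the two summands of the recurrence for the Stirling numbers.
\<close>

lemma covering_funs_insert:
  assumes "x \<notin> A" "b \<notin> B"
  shows "covering_funs (insert x A) b B =
    (\<lambda>(y, g). g(x := y)) `
      (insert b B \<times> covering_funs A b B \<union> (SIGMA y:B. covering_funs A b (B - {y})))"
    (is "?L = ?upd ` ?P")
proof (intro equalityI subsetI)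
  fix f assume "f \<in> ?L"
  then have f: "f \<in> insert x A \<rightarrow>\<^sub>E insert b B" and cov: "B \<subseteq> f ` insert x A"
    by (auto simp: covering_funs_def)
  from f obtain y g where yg: "f = g(x := y)" "y \<in> insert b B" "g \<in> A \<rightarrow>\<^sub>E insert b B"
    unfolding PiE_insert_eq by auto
  have im: "f ` insert x A = insert y (g ` A)"
    using yg(1) assms(1) by (auto simp: image_iff)
  have "(y, g) \<in> ?P"
  proof (cases "B \<subseteq> g ` A")
    case True
    then show ?thesis using yg by (auto simp: covering_funs_def)
  next
    case False
    then have y: "y \<in> B" "y \<notin> g ` A" using cov im by auto
    then have "g \<in> A \<rightarrow>\<^sub>E insert b (B - {y})" using yg(3) by (fastforce simp: PiE_iff)
    then show ?thesis using y cov im by (auto simp: covering_funs_def)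
  qed
  then show "f \<in> ?upd ` ?P" using yg(1) by force
next
  fix f assume "f \<in> ?upd ` ?P"
  then obtain y g where yg: "f = g(x := y)" "(y, g) \<in> ?P" by auto
  have im: "f ` insert x A = insert y (g ` A)"
    using yg(1) assms(1) by (auto simp: image_iff)
  have "y \<in> insert b B" "g \<in> A \<rightarrow>\<^sub>E insert b B" "B \<subseteq> insert y (g ` A)"
    using yg(2) by (auto simp: covering_funs_def PiE_iff)
  then show "f \<in> ?L" using im yg(1) by (auto simp: covering_funs_def intro!: PiE_fun_upd)
qed

lemma card_covering_funs:
  fixes A :: "'a set" and B :: "'b set"
  assumes "finite A" "finite B" "b \<notin> B"
  shows "card (covering_funs A b B) = fact (card B) * Stirling (Suc (card A)) (Suc (card B))"
  using assms
proof (induction A arbitrary: B rule: finite_induct)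
  case empty
  have "covering_funs ({} :: 'a set) b B = (if B = {} then {\<lambda>_. undefined} else {})"
    by (auto simp: covering_funs_def)
  then show ?case
  proof (cases "B = {}")
    case False
    then obtain k where "card B = Suc k" using empty.prems(1) by (cases "card B") auto
    then show ?thesis using \<open>covering_funs {} b B = _\<close> False by simp
  qed simp_all
next
  case (insert x A)
  let ?upd = "\<lambda>(y::'b, g::'a \<Rightarrow> 'b). g(x := y)"
  let ?P = "insert b B \<times> covering_funs A b B" and ?Q = "SIGMA y:B. covering_funs A b (B - {y})"
  have inj: "inj_on ?upd (?P \<union> ?Q)"
  proof (rule inj_onI, clarify)
    fix y g y' g'
    assume yg: "(y, g) \<in> ?P \<union> ?Q" "(y', g') \<in> ?P \<union> ?Q" and eq: "g(x := y) = g'(x := y')"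
    have "g x = g' x"
      using yg insert.hyps(2) by (auto simp: covering_funs_def PiE_iff extensional_def)
    then show "y = y' \<and> g = g'" using eq by (metis fun_upd_eqD fun_upd_triv fun_upd_upd)
  qed
  have disj: "?P \<inter> ?Q = {}" using insert.prems by (auto simp: covering_funs_def PiE_iff)
  have fin: "finite ?P" "finite ?Q"
    using insert.hyps insert.prems by (auto intro!: finite_covering_funs)
  have cQ: "card ?Q = card B * (fact (card B - 1) * Stirling (Suc (card A)) (card B))"
  proof -
    have "card ?Q = (\<Sum>y\<in>B. card (covering_funs A b (B - {y})))"
      using insert.hyps insert.prems by (intro card_SigmaI) (auto intro!: finite_covering_funs)
    also have "\<dots> = (\<Sum>y\<in>B. fact (card B - 1) * Stirling (Suc (card A)) (card B))"
    proof (rule sum.cong[OF refl])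
      fix y assume y: "y \<in> B"
      then have "0 < card B" using insert.prems by (auto simp: card_gt_0_iff)
      then show "card (covering_funs A b (B - {y})) =
          fact (card B - 1) * Stirling (Suc (card A)) (card B)"
        using insert.IH[of "B - {y}"] insert.prems y by simp
    qed
    finally show ?thesis by simp
  qed
  have "card (covering_funs (insert x A) b B) = card ?P + card ?Q"
    unfolding covering_funs_insert[OF insert.hyps(2) insert.prems(2)]
    using card_image[OF inj] card_Un_disjoint[OF fin disj] by simp
  also have "card ?P = Suc (card B) * (fact (card B) * Stirling (Suc (card A)) (Suc (card B)))"
    using insert by (simp add: card_cartesian_product)
  also have "card ?Q = fact (card B) * Stirling (Suc (card A)) (card B)"
    unfolding cQ by (cases "card B") (simp_all add: algebra_simps)
  finally show ?case using insert.hyps by (simp add: algebra_simps)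
qed

section \<open>Ferrers relations and their ranks\<close>

text \<open>
  The name comes from Ferrers diagrams: sorting the rows and columns by size turns the 0-1 matrix of
  such a relation into the diagram of an integer partition.
\<close>

definition ferrers_relations :: "'a set \<Rightarrow> 'b set \<Rightarrow> ('a \<times> 'b) set set" where
  "ferrers_relations U V =
    {R. R \<subseteq> U \<times> V \<and> (\<forall>u\<in>U. \<forall>u'\<in>U. R `` {u} \<subseteq> R `` {u'} \<or> R `` {u'} \<subseteq> R `` {u})}"

definition threshold_relation ::
  "'a set \<Rightarrow> 'b set \<Rightarrow> ('a \<Rightarrow> nat) \<Rightarrow> ('b \<Rightarrow> nat) \<Rightarrow> ('a \<times> 'b) set" where
  "threshold_relation U V f g = {(u, v) \<in> U \<times> V. g v < f u}"

text \<open>Only non-empty rows are collected, because the domain consists of the elements with such a row.\<close>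

definition rows :: "('a \<times> 'b) set \<Rightarrow> 'b set set" where
  "rows R = (\<lambda>u. R `` {u}) ` Domain R"

definition row_rank :: "('a \<times> 'b) set \<Rightarrow> 'a \<Rightarrow> nat" where
  "row_rank R u = card {C \<in> rows R. C \<subseteq> R `` {u}}"

definition col_rank :: "('a \<times> 'b) set \<Rightarrow> 'b \<Rightarrow> nat" where
  "col_rank R v = card {C \<in> rows R. v \<notin> C}"

lemma threshold_relation_ferrers: "threshold_relation U V f g \<in> ferrers_relations U V"
proof -
  have "threshold_relation U V f g `` {u} = {v \<in> V. g v < f u}" if "u \<in> U" for u
    using that by (auto simp: threshold_relation_def)
  moreover have "{v \<in> V. g v < f u} \<subseteq> {v \<in> V. g v < f u'} \<or>
      {v \<in> V. g v < f u'} \<subseteq> {v \<in> V. g v < f u}" for u u'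
    by (cases "f u \<le> f u'") auto
  moreover have "threshold_relation U V f g \<subseteq> U \<times> V" by (auto simp: threshold_relation_def)
  ultimately show ?thesis by (simp add: ferrers_relations_def)
qed

text \<open>
  The row of \<open>u\<close> is the initial segment \<open>{v \<in> V. g v < f u}\<close>. Since \<open>g\<close> attains every value below \<open>j\<close>,
  the segments with bounds \<open>0, \<dots>, j\<close> increase strictly, and since \<open>f\<close> attains every value in \<open>{1..j}\<close>,
  all the non-empty segments occur as rows. Hence the sets counted by the two ranks are segments with
  bounds \<open>1, \<dots>, f u\<close> and \<open>1, \<dots>, g v\<close>: a normalised pair of thresholds can be read off
  from its relation.
\<close>

lemma ranks_threshold_relation:
  assumes f: "f \<in> covering_funs U 0 {1..j}" and g: "g \<in> covering_funs V j {..<j}"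
  defines "R \<equiv> threshold_relation U V f g"
  shows "card (rows R) = j"
    and "u \<in> U \<Longrightarrow> row_rank R u = f u"
    and "v \<in> V \<Longrightarrow> col_rank R v = g v"
proof -
  \<comment> \<open>the possible rows\<close>
  define T where "T i = {v \<in> V. g v < i}" for i
  have f_le: "f u \<le> j" if "u \<in> U" for u
    using f that by (fastforce simp: covering_funs_def PiE_iff)
  have g_le: "g v \<le> j" if "v \<in> V" for v
    using g that by (fastforce simp: covering_funs_def PiE_iff)
  have row: "R `` {u} = T (f u)" if "u \<in> U" for u
    using that by (auto simp: R_def threshold_relation_def T_def)
  have T_mono: "T i \<subseteq> T i' \<longleftrightarrow> i \<le> i'" if "i \<le> j" for i i'
  proof
    assume sub: "T i \<subseteq> T i'"
    show "i \<le> i'"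
    proof (rule ccontr)
      assume "\<not> i \<le> i'"
      then have "i' \<in> {..<j}" "i' < i" using that by auto
      then obtain v where "v \<in> V" "g v = i'" using g by (auto simp: covering_funs_def)
      then show False using sub \<open>i' < i\<close> by (auto simp: T_def)
    qed
  qed (auto simp: T_def)
  have T_inj: "inj_on T {1..j}"
    by (rule inj_onI) (metis T_mono atLeastAtMost_iff order_antisym order_refl)
  have Dom: "Domain R = {u \<in> U. f u \<noteq> 0}"
  proof -
    have "u \<in> Domain R \<longleftrightarrow> \<not> T (f u) \<subseteq> T 0" if "u \<in> U" for u
      using row[OF that] by (auto simp: T_def)
    moreover have "Domain R \<subseteq> U" by (auto simp: R_def threshold_relation_def)
    ultimately show ?thesis using T_mono f_le by auto
  qed
  have rows: "rows R = T ` {1..j}"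
  proof -
    have "f ` Domain R \<subseteq> {1..j}" using f_le unfolding Dom by (auto simp: Suc_le_eq)
    moreover have "{1..j} \<subseteq> f ` Domain R"
    proof
      fix i assume i: "i \<in> {1..j}"
      then obtain u where "u \<in> U" "f u = i" using f by (auto simp: covering_funs_def)
      then show "i \<in> f ` Domain R" using i unfolding Dom by auto
    qed
    ultimately have "f ` Domain R = {1..j}" by (rule equalityI)
    moreover have "rows R = T ` f ` Domain R"
      unfolding rows_def image_image using row Dom by (intro image_cong) auto
    ultimately show ?thesis by simp
  qed
  show "card (rows R) = j" unfolding rows using card_image[OF T_inj] by simp
  have card_T: "card (T ` {1..i}) = i" if "i \<le> j" for i
    using card_image[OF inj_on_subset[OF T_inj], of "{1..i}"] that by simp
  show "row_rank R u = f u" if "u \<in> U"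
  proof -
    have "{C \<in> rows R. C \<subseteq> R `` {u}} = T ` {1..f u}"
    proof -
      have "{C \<in> rows R. C \<subseteq> R `` {u}} = T ` {i \<in> {1..j}. T i \<subseteq> T (f u)}"
        unfolding rows row[OF that] by blast
      also have "{i \<in> {1..j}. T i \<subseteq> T (f u)} = {i \<in> {1..j}. i \<le> f u}"
        by (intro Collect_cong conj_cong refl T_mono) simp
      also have "\<dots> = {1..f u}" using f_le[OF that] by auto
      finally show ?thesis .
    qed
    then show ?thesis using card_T f_le[OF that] by (simp add: row_rank_def)
  qed
  show "col_rank R v = g v" if "v \<in> V"
  proof -
    have "{C \<in> rows R. v \<notin> C} = T ` {1..g v}"
      unfolding rows using that g_le[OF that] by (auto simp: T_def)
    then show ?thesis using card_T g_le[OF that] by (simp add: col_rank_def)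
  qed
qed

text \<open>
  If \<open>v\<close> lies in the row of \<open>u\<close>, then every row avoiding \<open>v\<close> is contained in that row, by comparability,
  and the row of \<open>u\<close> itself makes the inclusion of the counted sets strict. If \<open>v\<close> does not lie in it,
  every row contained in it avoids \<open>v\<close>, and the inclusion is reversed.
\<close>

lemma rank_less_iff:
  assumes R: "R \<in> ferrers_relations U V" and fin: "finite U" and u: "u \<in> U"
  shows "col_rank R v < row_rank R u \<longleftrightarrow> (u, v) \<in> R"
proof
  have finr: "finite (rows R)"
    using fin R finite_subset[of "Domain R" U] by (auto simp: rows_def ferrers_relations_def)
  {
    assume "(u, v) \<in> R"
    then have uv: "v \<in> R `` {u}" "R `` {u} \<in> rows R" by (auto simp: rows_def)
    have "C \<subseteq> R `` {u}" if "C \<in> rows R" "v \<notin> C" for C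
      using that R u uv(1) unfolding rows_def ferrers_relations_def by blast
    then have "{C \<in> rows R. v \<notin> C} \<subset> {C \<in> rows R. C \<subseteq> R `` {u}}" using uv by blast
    then show "col_rank R v < row_rank R u"
      unfolding col_rank_def row_rank_def by (rule psubset_card_mono[rotated]) (use finr in simp)
  }
  assume less: "col_rank R v < row_rank R u"
  show "(u, v) \<in> R"
  proof (rule ccontr)
    assume "(u, v) \<notin> R"
    then have "{C \<in> rows R. C \<subseteq> R `` {u}} \<subseteq> {C \<in> rows R. v \<notin> C}" by auto
    then have "row_rank R u \<le> col_rank R v"
      unfolding col_rank_def row_rank_def by (rule card_mono[rotated]) (use finr in simp)
    then show False using less by simp
  qed
qed

lemma threshold_relation_ranks:
  assumes "R \<in> ferrers_relations U V" "finite U"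
  shows "threshold_relation U V (row_rank R) (col_rank R) = R"
proof -
  have "R \<subseteq> U \<times> V" using assms(1) by (simp add: ferrers_relations_def)
  then show ?thesis using rank_less_iff[OF assms] by (auto simp: threshold_relation_def)
qed

text \<open>
  In a finite chain of \<open>j\<close> sets, counting the members below a given one enumerates \<open>{1..j}\<close>; this
  settles the row ranks. If some \<open>i < j\<close> were not a column rank, then the conditions
  \<open>col_rank R v < i\<close> and \<open>col_rank R v < i + 1\<close> would be equivalent, so the row of rank \<open>i + 1\<close> would
  equal the row of rank \<open>i\<close>, or be empty when \<open>i = 0\<close>.
\<close>

lemma ranks_covering:
  assumes R: "R \<in> ferrers_relations U V" and fin: "finite U"
  shows "restrict (row_rank R) U \<in> covering_funs U 0 {1..card (rows R)}"
    and "restrict (col_rank R) V \<in> covering_funs V (card (rows R)) {..<card (rows R)}"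
proof -
  let ?j = "card (rows R)"
  have sub: "R \<subseteq> U \<times> V" using R by (simp add: ferrers_relations_def)
  have finr: "finite (rows R)"
    using fin sub finite_subset[of "Domain R" U] by (auto simp: rows_def)
  have row_le: "row_rank R u \<le> ?j" for u
    unfolding row_rank_def using finr by (auto intro: card_mono)
  have col_le: "col_rank R v \<le> ?j" for v
    unfolding col_rank_def using finr by (auto intro: card_mono)
  define h where "h C = card {D \<in> rows R. D \<subseteq> C}" for C
  have h_inj: "inj_on h (rows R)"
  proof (rule inj_onI)
    fix C D assume CD: "C \<in> rows R" "D \<in> rows R" "h C = h D"
    have strict: "h C < h D" if "C \<subset> D" "D \<in> rows R" for C D
      unfolding h_def by (rule psubset_card_mono) (use finr that in auto)
    obtain u w where "u \<in> U" "w \<in> U" "C = R `` {u}" "D = R `` {w}"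
      using CD(1,2) sub by (auto simp: rows_def)
    then have "C \<subseteq> D \<or> D \<subseteq> C" using R by (simp add: ferrers_relations_def)
    then show "C = D" using strict CD by (metis less_irrefl psubsetI)
  qed
  have "h ` rows R \<subseteq> {1..?j}"
    using finr by (auto simp: h_def Suc_le_eq card_gt_0_iff intro: card_mono)
  then have h_im: "h ` rows R = {1..?j}"
    using card_image[OF h_inj] by (intro card_subset_eq) auto
  have ex_row: "\<exists>u\<in>U. R `` {u} \<in> rows R \<and> row_rank R u = i" if i: "i \<in> {1..?j}" for i
  proof -
    from i h_im obtain C where "C \<in> rows R" "h C = i" by (metis imageE)
    then obtain u where "u \<in> Domain R" "C = R `` {u}" by (auto simp: rows_def)
    then show ?thesis using \<open>C \<in> rows R\<close> \<open>h C = i\<close> sub by (auto simp: row_rank_def h_def)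
  qed
  have "restrict (row_rank R) U \<in> U \<rightarrow>\<^sub>E insert 0 {1..?j}"
    using row_le by (auto simp: PiE_iff Suc_le_eq)
  moreover have "{1..?j} \<subseteq> row_rank R ` U" using ex_row by blast
  ultimately show "restrict (row_rank R) U \<in> covering_funs U 0 {1..?j}"
    by (simp add: covering_funs_def)
  have ex_col: "\<exists>v\<in>V. col_rank R v = i" if i: "i < ?j" for i
  proof (rule ccontr)
    assume none: "\<not> ?thesis"
    have "Suc i \<in> {1..?j}" using i by simp
    then obtain u where u: "u \<in> U" "R `` {u} \<in> rows R" "row_rank R u = Suc i"
      using ex_row by blast
    have row_u: "R `` {u} = {v \<in> V. col_rank R v < i}"
      using rank_less_iff[OF R fin u(1)] u(3) none sub by (auto simp: less_Suc_eq)
    show False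
    proof (cases "i = 0")
      case True
      then show False using u(2) row_u by (auto simp: rows_def)
    next
      case False
      then have "i \<in> {1..?j}" using i by simp
      then obtain w where w: "w \<in> U" "row_rank R w = i" using ex_row by blast
      have "R `` {w} = {v \<in> V. col_rank R v < i}"
        using rank_less_iff[OF R fin w(1)] w(2) sub by auto
      then have "row_rank R w = row_rank R u" using row_u by (simp add: row_rank_def)
      then show False using u w by simp
    qed
  qed
  have "restrict (col_rank R) V \<in> V \<rightarrow>\<^sub>E insert ?j {..<?j}"
    using col_le by (auto simp: PiE_iff le_less)
  moreover have "{..<?j} \<subseteq> col_rank R ` V" using ex_col by blast
  ultimately show "restrict (col_rank R) V \<in> covering_funs V ?j {..<?j}"
    by (simp add: covering_funs_def)
qed

text \<open>
  The bound on \<open>j\<close> excludes nothing: for larger \<open>j\<close> one of the two sets of covering functions is empty.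
\<close>

lemma bij_betw_threshold_relation:
  fixes U :: "'a set" and V :: "'b set"
  assumes fin: "finite U" "finite V"
  shows "bij_betw (\<lambda>(j, f, g). threshold_relation U V f g)
    (SIGMA j:{..min (card U) (card V)}. covering_funs U 0 {1..j} \<times> covering_funs V j {..<j})
    (ferrers_relations U V)" (is "bij_betw ?\<phi> ?S _")
proof (rule bij_betw_byWitness[where f' =
      "\<lambda>R. (card (rows R), restrict (row_rank R) U, restrict (col_rank R) V)"])
  show "\<forall>p\<in>?S. (card (rows (?\<phi> p)), restrict (row_rank (?\<phi> p)) U, restrict (col_rank (?\<phi> p)) V) = p"
  proof (rule ballI)
    fix p assume "p \<in> ?S"
    then obtain j f g where p: "p = (j, f, g)"
      and f: "f \<in> covering_funs U 0 {1..j}" and g: "g \<in> covering_funs V j {..<j}"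
      by blast
    let ?R = "threshold_relation U V f g"
    note rk = ranks_threshold_relation[OF f g]
    have "restrict (row_rank ?R) U = f" "restrict (col_rank ?R) V = g"
      using f g rk(2,3)
      by (simp_all add: covering_funs_def PiE_iff extensional_restrict cong: restrict_cong)
    then show "(card (rows (?\<phi> p)), restrict (row_rank (?\<phi> p)) U, restrict (col_rank (?\<phi> p)) V) = p"
      using rk(1) p by simp
  qed
next
  have "threshold_relation U V (restrict f U) (restrict g V) = threshold_relation U V f g"
    for f :: "'a \<Rightarrow> nat" and g :: "'b \<Rightarrow> nat"
    by (auto simp: threshold_relation_def)
  then show "\<forall>R\<in>ferrers_relations U V.
      ?\<phi> (card (rows R), restrict (row_rank R) U, restrict (col_rank R) V) = R"
    by (simp add: threshold_relation_ranks[OF _ fin(1)])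
next
  show "?\<phi> ` ?S \<subseteq> ferrers_relations U V" using threshold_relation_ferrers by auto
next
  have "card (rows R) \<le> min (card U) (card V)" if R: "R \<in> ferrers_relations U V" for R
  proof -
    have "card {1..card (rows R)} \<le> card U" "card {..<card (rows R)} \<le> card V"
      using ranks_covering[OF R fin(1)] fin unfolding covering_funs_def
      by (metis (mono_tags, lifting) mem_Collect_eq surj_card_le)+
    then show ?thesis by simp
  qed
  then show "(\<lambda>R. (card (rows R), restrict (row_rank R) U, restrict (col_rank R) V)) `
      ferrers_relations U V \<subseteq> ?S"
    by (intro image_subsetI SigmaI ranks_covering[OF _ fin(1)]) simp_all
qed

lemma card_ferrers_relations:
  assumes fin: "finite U" "finite V"
  shows "card (ferrers_relations U V) = (\<Sum>j\<le>min (card U) (card V).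
    (fact j)\<^sup>2 * Stirling (Suc (card U)) (Suc j) * Stirling (Suc (card V)) (Suc j))"
proof -
  have "card (ferrers_relations U V) = (\<Sum>j\<le>min (card U) (card V).
      card (covering_funs U 0 {1..j} \<times> covering_funs V j {..<j}))"
    unfolding bij_betw_same_card[OF bij_betw_threshold_relation[OF fin], symmetric]
    by (rule card_SigmaI) (auto intro!: finite_covering_funs fin)
  also have "\<dots> = (\<Sum>j\<le>min (card U) (card V).
      (fact j)\<^sup>2 * Stirling (Suc (card U)) (Suc j) * Stirling (Suc (card V)) (Suc j))"
    by (intro sum.cong refl)
      (simp add: card_cartesian_product card_covering_funs fin power2_eq_square del: Stirling.simps)
  finally show ?thesis .
qed

section \<open>Acyclic orientations as Ferrers relations\<close>

lemma (in pre_digraph) no_cycle_if_decreasing: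
  fixes h :: "'a \<Rightarrow> nat"
  assumes "\<And>x y. x \<rightarrow> y \<Longrightarrow> h y < h x"
  shows "\<not> cycle p"
proof
  assume "cycle p"
  then obtain u where u: "awalk u p u" "p \<noteq> []" by (auto simp: cycle_def)
  have "h v \<le> h u \<and> (p \<noteq> [] \<longrightarrow> h v < h u)" if "cas u p v" "set p \<subseteq> arcs G" for u v p
    using that
  proof (induction p arbitrary: u)
    case (Cons e es)
    then have "h (head G e) < h u" using assms[of u "head G e"] by (auto simp: arcs_ends_conv)
    moreover have "h v \<le> h (head G e)" using Cons by simp
    ultimately show ?case by simp
  qed simp
  from this[of u p u] u show False by (auto simp: awalk_def)
qed

lemma (in wf_digraph) cycle_if_quadrangle:
  assumes "a \<rightarrow> b" "b \<rightarrow> c" "c \<rightarrow> d" "d \<rightarrow> a"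
  shows "\<exists>p. cycle p"
proof -
  obtain e1 where "e1 \<in> arcs G" "tail G e1 = a" "head G e1 = b" using assms(1) by (rule reachableE)
  moreover obtain e2 where "e2 \<in> arcs G" "tail G e2 = b" "head G e2 = c" using assms(2) by (rule reachableE)
  moreover obtain e3 where "e3 \<in> arcs G" "tail G e3 = c" "head G e3 = d" using assms(3) by (rule reachableE)
  moreover obtain e4 where "e4 \<in> arcs G" "tail G e4 = d" "head G e4 = a" using assms(4) by (rule reachableE)
  ultimately have "awalk a [e1, e2, e3, e4] a" by (auto simp: awalk_simps)
  then have "closed_w [e1, e2, e3, e4]" by (auto simp: closed_w_def)
  then show ?thesis by (rule closed_w_imp_cycle)
qed

definition arcs_of_relation :: "'a set \<Rightarrow> 'a set \<Rightarrow> ('a \<times> 'a) set \<Rightarrow> ('a \<times> 'a) set" where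
  "arcs_of_relation U V R = R \<union> (U \<times> V - R)\<inverse>"

definition orient_by ::
  "('a, 'b) pre_digraph \<Rightarrow> 'a set \<Rightarrow> 'a set \<Rightarrow> ('a \<times> 'a) set \<Rightarrow> ('a, 'b) pre_digraph" where
  "orient_by G U V R = \<lparr>verts = verts G,
    arcs = {e \<in> arcs G. arc_to_ends G e \<in> arcs_of_relation U V R}, tail = tail G, head = head G\<rparr>"

context
  fixes G :: "('a, 'b) pre_digraph" and U V :: "'a set"
  assumes graph: "graph G"
    and disjoint: "U \<inter> V = {}"
    and edges: "arcs_ends G = U \<times> V \<union> V \<times> U"
begin

interpretation graph G by (rule graph)

lemma arcs_ends_orient_by:
  assumes "R \<subseteq> U \<times> V"
  shows "arcs_ends (orient_by G U V R) = arcs_of_relation U V R"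
proof -
  have ends: "arc_to_ends (orient_by G U V R) = arc_to_ends G"
    by (rule ext) (simp add: arc_to_ends_def orient_by_def)
  have "arcs_of_relation U V R \<subseteq> arcs_ends G"
    using assms by (auto simp: edges arcs_of_relation_def)
  then show ?thesis
    unfolding arcs_ends_def ends by (auto simp: orient_by_def)
qed

lemma orientation_orient_by:
  assumes R: "R \<subseteq> U \<times> V"
  shows "orientation (orient_by G U V R) G"
proof -
  have "wf_digraph (orient_by G U V R)" by unfold_locales (auto simp: orient_by_def)
  then have "spanning (orient_by G U V R) G"
    using wf_digraph by (auto simp: spanning_def subgraph_def compatible_def orient_by_def)
  then show ?thesis
    using R disjoint unfolding orientation_def arcs_ends_orient_by[OF R] edges arcs_of_relation_def
    by auto
qed

text \<open>
  Incomparable rows produce a quadrangle \<open>u, v, u', v'\<close>. Nested rows have ranks, and doubling them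
  interleaves the two parts: \<open>col_rank R v < row_rank R u\<close> iff \<open>2 * col_rank R v + 1 < 2 * row_rank R u\<close>,
  while the shift by one breaks the ties in favour of arcs from \<open>V\<close> to \<open>U\<close>.
\<close>

lemma acyclic_orient_by_iff:
  assumes R: "R \<subseteq> U \<times> V" and fin: "finite U"
  shows "(\<nexists>p. pre_digraph.cycle (orient_by G U V R) p) \<longleftrightarrow> R \<in> ferrers_relations U V"
proof
  let ?D = "orient_by G U V R"
  have wf: "wf_digraph ?D" by unfold_locales (auto simp: orient_by_def)
  assume acyc: "\<nexists>p. pre_digraph.cycle ?D p"
  have "R `` {u} \<subseteq> R `` {u'} \<or> R `` {u'} \<subseteq> R `` {u}" if u: "u \<in> U" "u' \<in> U" for u u'
  proof (rule ccontr)
    assume "\<not> ?thesis"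
    then obtain v v' where "(u, v) \<in> R" "(u', v) \<notin> R" "(u', v') \<in> R" "(u, v') \<notin> R" by auto
    then have "u \<rightarrow>\<^bsub>?D\<^esub> v" "v \<rightarrow>\<^bsub>?D\<^esub> u'" "u' \<rightarrow>\<^bsub>?D\<^esub> v'" "v' \<rightarrow>\<^bsub>?D\<^esub> u"
      using R u unfolding arcs_ends_orient_by[OF R] arcs_of_relation_def by auto
    then show False using wf_digraph.cycle_if_quadrangle[OF wf] acyc by blast
  qed
  then show "R \<in> ferrers_relations U V" using R by (auto simp: ferrers_relations_def)
next
  let ?D = "orient_by G U V R"
  assume F: "R \<in> ferrers_relations U V"
  define h where "h x = (if x \<in> U then 2 * row_rank R x else 2 * col_rank R x + 1)" for x
  have "h y < h x" if "x \<rightarrow>\<^bsub>?D\<^esub> y" for x y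
  proof -
    from that consider "(x, y) \<in> R" "x \<in> U" "y \<notin> U" | "(y, x) \<notin> R" "y \<in> U" "x \<notin> U"
      using R disjoint unfolding arcs_ends_orient_by[OF R] arcs_of_relation_def by auto
    then show ?thesis
    proof cases
      case 1
      then show ?thesis using rank_less_iff[OF F fin, of x y] by (simp add: h_def)
    next
      case 2
      then show ?thesis using rank_less_iff[OF F fin, of y x] by (simp add: h_def)
    qed
  qed
  then show "\<nexists>p. pre_digraph.cycle ?D p" using pre_digraph.no_cycle_if_decreasing by blast
qed

text \<open>
  An orientation shares all fields except its arc set with \<open>G\<close>. As \<open>G\<close> has no parallel arcs, the
  arc set can be recovered from the pairs of end points, and of the two arcs of an edge exactly one
  is kept, so these pairs are known once those in \<open>U \<times> V\<close> are.
\<close>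

lemma orientation_eq_orient_by:
  assumes D: "orientation D G"
  shows "D = orient_by G U V (arcs_ends D \<inter> U \<times> V)"
proof -
  let ?R = "arcs_ends D \<inter> U \<times> V"
  have sub: "arcs D \<subseteq> arcs G" "verts D = verts G" "tail D = tail G" "head D = head G"
    using D by (auto simp: orientation_def spanning_def subgraph_def compatible_def)
  then have ends: "arcs_ends D = arc_to_ends G ` arcs D"
    by (simp add: arcs_ends_def arc_to_ends_def)
  have in_edges: "arcs_ends D \<subseteq> U \<times> V \<union> V \<times> U"
    using sub(1) unfolding ends edges[symmetric] arcs_ends_def[of G] by (rule image_mono)
  have one_dir: "(u, v) \<in> arcs_ends D \<longleftrightarrow> (v, u) \<notin> arcs_ends D" if "u \<in> U" "v \<in> V" for u v
  proof -
    have "(u, v) \<in> arcs_ends G" using that by (simp add: edges)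
    then show ?thesis using D unfolding orientation_def by blast
  qed
  have "arcs_ends D = arcs_of_relation U V ?R"
    unfolding arcs_of_relation_def
  proof (intro equalityI subrelI)
    fix x y assume "(x, y) \<in> arcs_ends D"
    then show "(x, y) \<in> ?R \<union> (U \<times> V - ?R)\<inverse>" using in_edges one_dir[of y x] by blast
  next
    fix x y assume "(x, y) \<in> ?R \<union> (U \<times> V - ?R)\<inverse>"
    then show "(x, y) \<in> arcs_ends D" using one_dir[of y x] by blast
  qed
  then have "arcs D = {e \<in> arcs G. arc_to_ends G e \<in> arcs_of_relation U V ?R}"
    using sub(1) ends inj_on_image_mem_iff[OF inj_on_arc_to_ends _ sub(1)] by blast
  then show ?thesis using sub by (simp add: orient_by_def)
qed

lemma acyclic_orientations_eq:
  assumes "finite U"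
  shows "{D. acyclic_orientation D G} = orient_by G U V ` ferrers_relations U V"
proof (intro equalityI subsetI)
  fix D assume "D \<in> {D. acyclic_orientation D G}"
  then have D: "orientation D G" "\<nexists>p. pre_digraph.cycle D p" by (auto simp: acyclic_orientation_def)
  let ?R = "arcs_ends D \<inter> U \<times> V"
  have "\<nexists>p. pre_digraph.cycle (orient_by G U V ?R) p"
    using D(2) unfolding orientation_eq_orient_by[OF D(1), symmetric] .
  then have "?R \<in> ferrers_relations U V"
    using acyclic_orient_by_iff[of ?R] assms by simp
  then show "D \<in> orient_by G U V ` ferrers_relations U V"
    by (rule rev_image_eqI) (rule orientation_eq_orient_by[OF D(1)])
next
  fix D assume "D \<in> orient_by G U V ` ferrers_relations U V"
  then obtain R where R: "R \<in> ferrers_relations U V" "D = orient_by G U V R" by blast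
  then have "R \<subseteq> U \<times> V" by (simp add: ferrers_relations_def)
  then have "\<nexists>p. pre_digraph.cycle D p" "orientation D G"
    using R acyclic_orient_by_iff[of R] orientation_orient_by[of R] assms by simp_all
  then show "D \<in> {D. acyclic_orientation D G}" by (simp add: acyclic_orientation_def)
qed

lemma inj_on_orient_by: "inj_on (orient_by G U V) (ferrers_relations U V)"
proof (rule inj_on_inverseI[where g = "\<lambda>D. arcs_ends D \<inter> U \<times> V"])
  fix R assume "R \<in> ferrers_relations U V"
  then have "R \<subseteq> U \<times> V" by (simp add: ferrers_relations_def)
  then show "arcs_ends (orient_by G U V R) \<inter> U \<times> V = R"
    unfolding arcs_ends_orient_by[OF \<open>R \<subseteq> U \<times> V\<close>] arcs_of_relation_def
    using disjoint by auto
qed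

lemma num_acyclic_orientations_eq_card_ferrers:
  assumes "finite U"
  shows "num_acyclic_orientations G = card (ferrers_relations U V)"
  unfolding num_acyclic_orientations_def acyclic_orientations_eq[OF assms]
  by (rule card_image[OF inj_on_orient_by])

end

theorem theorem3p1:
  fixes n1 n2 :: nat and G :: "('a,'b) pre_digraph"
  assumes "n1 \<ge> 1" and "n2 \<ge> 1"
    and "complete_bipartite_digraph n1 n2 G"
  shows "num_acyclic_orientations G =
    (\<Sum>j = 1..min (n1 + 1) (n2 + 1). (fact (j - 1))\<^sup>2 * Stirling (n1 + 1) j * Stirling (n2 + 1) j)"
proof -
  from assms(3) obtain U V where G: "graph G" and UV: "verts G = U \<union> V" "U \<inter> V = {}"
    and card: "card U = n1" "card V = n2" and edges: "arcs_ends G = U \<times> V \<union> V \<times> U"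
    unfolding complete_bipartite_digraph_def by blast
  interpret graph G by (rule G)
  have fin: "finite U" "finite V" using finite_verts unfolding UV(1) by auto
  have "num_acyclic_orientations G = (\<Sum>j\<le>min n1 n2.
      (fact j)\<^sup>2 * Stirling (Suc n1) (Suc j) * Stirling (Suc n2) (Suc j))"
    using num_acyclic_orientations_eq_card_ferrers[OF G UV(2) edges fin(1)]
      card_ferrers_relations[OF fin] card by simp
  also have "\<dots> = (\<Sum>j = Suc 0..Suc (min n1 n2).
      (fact (j - 1))\<^sup>2 * Stirling (Suc n1) j * Stirling (Suc n2) j)"
    unfolding sum.shift_bounds_cl_Suc_ivl atLeast0AtMost by simp
  finally show ?thesis by simp
qed

end
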